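(* Let $(X,d)$ be a metric space and let $T : X \to X$ be a significant pointwise contractive (SPC) mapping, i.e. there exists $c \in [0,1)$ such that for all $x,y \in X$, $d(x,y) \leq d(x,Tx)$ implies $d(Tx,Ty) \leq c\, d(x,y)$. Then $T$ is continuous on $X$.
   Context: Let $(X,d)$ be a metric space. A mapping $T : X \to X$ is called significant pointwise contractive (SPC) if there exists $c \in [0,1)$ such that, for all $x,y \in X$, $d(x,y) \leq d(x,Tx)$ implies $d(Tx,Ty) \leq c\, d(x,y)$. *)

theory Defs
  imports "HOL-Analysis.Analysis"
begin

text \<open>Significant pointwise contractive (SPC) self-maps of the metric space with carrier \<open>X\<close> and
  distance \<open>d\<close>. Only the values of \<open>d\<close> and \<open>T\<close> on \<open>X\<close> matter.\<close>

definition SPC :: "'a set \<Rightarrow> ('a \<Rightarrow> 'a \<Rightarrow> real) \<Rightarrow> ('a \<Rightarrow> 'a) \<Rightarrow> bool" where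
  "SPC X d T \<longleftrightarrow>
     T \<in> X \<rightarrow> X \<and>
     (\<exists>c. 0 \<le> c \<and> c < 1 \<and>
        (\<forall>x\<in>X. \<forall>y\<in>X. d x y \<le> d x (T x) \<longrightarrow> d (T x) (T y) \<le> c * d x y))"

end

theory Submission
  imports Defs
begin

text \<open>Near a non-fixed point \<open>x\<close> the premise \<open>d x y \<le> d x (T x)\<close> holds automatically, so \<open>T\<close>
  contracts towards \<open>T x\<close>. At a fixed point \<open>x\<close> the condition is applied with the nearby point
  \<open>y\<close> in the first place: either it contracts, or \<open>d y (T y) < d y x\<close>, whence
  \<open>d x (T y) < 2 * d x y\<close>.\<close>

theorem theorem2p1:
  fixes X :: "'a set" and d :: "'a \<Rightarrow> 'a \<Rightarrow> real" and T :: "'a \<Rightarrow> 'a"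
  assumes "Metric_space X d"
    and "SPC X d T"
  shows "continuous_map (Metric_space.mtopology X d) (Metric_space.mtopology X d) T"
proof -
  interpret Metric_space X d by fact
  obtain c where T: "T \<in> X \<rightarrow> X" and "c < 1"
    and c: "\<And>x y. \<lbrakk>x \<in> X; y \<in> X; d x y \<le> d x (T x)\<rbrakk> \<Longrightarrow> d (T x) (T y) \<le> c * d x y"
    using assms(2) unfolding SPC_def by blast
  \<comment> \<open>Both cases below use the contraction only in this form, so \<open>c\<close> does
    not enter the choice of \<open>\<delta>\<close>.\<close>
  have nonexp: "d (T x) (T y) \<le> d x y" if "x \<in> X" "y \<in> X" "d x y \<le> d x (T x)" for x y
    using c[OF that] mult_right_mono[of c 1 "d x y"] \<open>c < 1\<close> by simp
  have "\<exists>\<delta>>0. \<forall>y. y \<in> X \<and> d x y < \<delta> \<longrightarrow> d (T x) (T y) < \<epsilon>"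
    if x: "x \<in> X" and "\<epsilon> > 0" for x \<epsilon>
  proof (cases "T x = x")
    case True
    \<comment> \<open>The radius is halved to absorb the factor 2 lost when the premise fails at
      \<open>y\<close>.\<close>
    have "d (T x) (T y) < \<epsilon>" if y: "y \<in> X" "d x y < \<epsilon> / 2" for y
    proof (cases "d y x \<le> d y (T y)")
      case True
      then show ?thesis
        using nonexp[of y x] x y \<open>\<epsilon> > 0\<close> by (simp add: commute)
    next
      case False
      moreover have "d x (T y) \<le> d x y + d y (T y)"
        using triangle[of x y "T y"] x y T by auto
      ultimately show ?thesis
        using y commute[of x y] \<open>T x = x\<close> by simp
    qed
    with \<open>\<epsilon> > 0\<close> show ?thesis by (intro exI[of _ "\<epsilon> / 2"]) auto
  next
    case False
    then have "d x (T x) > 0"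
      using x T by (simp add: Pi_iff)
    \<comment> \<open>The bound \<open>d x (T x)\<close>, positive here, secures the premise of
      \<open>nonexp\<close> at \<open>x\<close>; the bound \<open>\<epsilon>\<close> then carries
      over to the images.\<close>
    moreover have "d (T x) (T y) < \<epsilon>" if "y \<in> X" "d x y < min \<epsilon> (d x (T x))" for y
      using nonexp[of x y] x that by simp
    ultimately show ?thesis
      using \<open>\<epsilon> > 0\<close> by (intro exI[of _ "min \<epsilon> (d x (T x))"]) auto
  qed
  then show ?thesis
    using T by (simp add: metric_continuous_map Metric_space_axioms image_subset_iff_funcset)
qed

end
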